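(* Let $R$ be a commutative ring with identity and let $S$ be a multiplicatively closed subset of $R$. Suppose $R$ is a $c$-$S$-coherent ring. Then $R$ is an $S$-coherent ring.
   Context: All modules are unitary. An $R$-module $M$ is called $S$-finite if there exist a finitely generated submodule $N$ of $M$ and an element $s\in S$ such that $sM\subseteq N\subseteq M$. An $R$-module $M$ is called $S$-finitely presented if there exists an exact sequence of $R$-modules $0\to K\to F\to M\to 0$ with $K$ $S$-finite and $F$ finitely generated free. The ring $R$ is called an $S$-coherent ring if every finitely generated ideal of $R$ is $S$-finitely presented. An $R$-module $M$ is called $c$-$S$-finitely presented if there exist a finitely presented submodule $N$ of $M$ and an element $s\in S$ such that $sM\subseteq N\subseteq M$. The ring $R$ is called $c$-$S$-coherent if every finitely generated ideal of $R$ is $c$-$S$-finitely presented (as an $R$-module). *)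

theory Defs
  imports "HOL-Algebra.Ideal" "Jordan_Normal_Form.Missing_VectorSpace"
begin

definition finitely_generated ::
  "('a, 'r) ring_scheme \<Rightarrow> ('a, 'b, 'm) module_scheme \<Rightarrow> bool" where
  "finitely_generated R M \<longleftrightarrow>
     module R M \<and>
     (\<exists>A. finite A \<and> A \<subseteq> carrier M \<and> LinearCombinations.module.span R M A = carrier M)"

definition finitely_generated_free ::
  "('a, 'r) ring_scheme \<Rightarrow> ('a, 'b, 'm) module_scheme \<Rightarrow> bool" where
  "finitely_generated_free R M \<longleftrightarrow>
     module R M \<and>
     (\<exists>B. finite B \<and> B \<subseteq> carrier M \<and> LinearCombinations.module.span R M B = carrier M \<and>
          \<not> LinearCombinations.module.lin_dep R M B)"

definition short_exact ::
  "('a, 'r) ring_scheme \<Rightarrow> ('a, 'k, 'l) module_scheme \<Rightarrow> ('k \<Rightarrow> 'f) \<Rightarrow>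
   ('a, 'f, 'h) module_scheme \<Rightarrow> ('f \<Rightarrow> 'b) \<Rightarrow> ('a, 'b, 'm) module_scheme \<Rightarrow> bool" where
  "short_exact R K f F g M \<longleftrightarrow>
     mod_hom R K F f \<and> mod_hom R F M g \<and>
     inj_on f (carrier K) \<and>
     f ` carrier K = {x \<in> carrier F. g x = \<zero>\<^bsub>M\<^esub>} \<and>
     g ` carrier F = carrier M"

definition S_finite ::
  "('a, 'r) ring_scheme \<Rightarrow> 'a set \<Rightarrow> ('a, 'b, 'm) module_scheme \<Rightarrow> bool" where
  "S_finite R S M \<longleftrightarrow>
     module R M \<and>
     (\<exists>N s. LinearCombinations.submodule R N M \<and>
            finitely_generated R (M\<lparr>carrier := N\<rparr>) \<and>
            s \<in> S \<and> (\<forall>x \<in> carrier M. s \<odot>\<^bsub>M\<^esub> x \<in> N))"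

(* In the next two definitions F and K range over modules whose elements have type nat => 'a.
   Nothing is lost: a free R-module with a basis of n elements is isomorphic to R^n, i.e. to
   ring.func_space R {..<n}, whose elements have that type, and K embeds into F. *)

definition finitely_presented ::
  "('a, 'r) ring_scheme \<Rightarrow> ('a, 'b, 'm) module_scheme \<Rightarrow> bool" where
  "finitely_presented R M \<longleftrightarrow>
     (\<exists>(K :: ('a, nat \<Rightarrow> 'a) module) (F :: ('a, nat \<Rightarrow> 'a) module) f g.
        short_exact R K f F g M \<and> finitely_generated R K \<and> finitely_generated_free R F)"

definition S_finitely_presented ::
  "('a, 'r) ring_scheme \<Rightarrow> 'a set \<Rightarrow> ('a, 'b, 'm) module_scheme \<Rightarrow> bool" where
  "S_finitely_presented R S M \<longleftrightarrow>
     (\<exists>(K :: ('a, nat \<Rightarrow> 'a) module) (F :: ('a, nat \<Rightarrow> 'a) module) f g.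
        short_exact R K f F g M \<and> S_finite R S K \<and> finitely_generated_free R F)"

definition c_S_finitely_presented ::
  "('a, 'r) ring_scheme \<Rightarrow> 'a set \<Rightarrow> ('a, 'b, 'm) module_scheme \<Rightarrow> bool" where
  "c_S_finitely_presented R S M \<longleftrightarrow>
     module R M \<and>
     (\<exists>N s. LinearCombinations.submodule R N M \<and>
            finitely_presented R (M\<lparr>carrier := N\<rparr>) \<and>
            s \<in> S \<and> (\<forall>x \<in> carrier M. s \<odot>\<^bsub>M\<^esub> x \<in> N))"

definition finitely_generated_ideal :: "('a, 'r) ring_scheme \<Rightarrow> 'a set \<Rightarrow> bool" where
  "finitely_generated_ideal R I \<longleftrightarrow>
     (\<exists>A. finite A \<and> A \<subseteq> carrier R \<and> I = Idl\<^bsub>R\<^esub> A)"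

(* The module record type extends the ring record type; its fields mult and one play no role
   for modules and are filled arbitrarily. *)
definition ideal_module :: "('a, 'r) ring_scheme \<Rightarrow> 'a set \<Rightarrow> ('a, 'a) module" where
  "ideal_module R I =
     \<lparr>carrier = I, mult = mult R, one = one R, zero = zero R, add = add R, smult = mult R\<rparr>"

definition S_coherent :: "('a, 'r) ring_scheme \<Rightarrow> 'a set \<Rightarrow> bool" where
  "S_coherent R S \<longleftrightarrow>
     (\<forall>I. finitely_generated_ideal R I \<longrightarrow> S_finitely_presented R S (ideal_module R I))"

definition c_S_coherent :: "('a, 'r) ring_scheme \<Rightarrow> 'a set \<Rightarrow> bool" where
  "c_S_coherent R S \<longleftrightarrow>
     (\<forall>I. finitely_generated_ideal R I \<longrightarrow> c_S_finitely_presented R S (ideal_module R I))"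

end

theory Submission
  imports Defs
begin

text \<open>Let \<open>s M \<subseteq> N \<subseteq> M\<close> with \<open>M\<close> finitely generated and \<open>N\<close> finitely presented, let
  \<open>\<phi> : F \<rightarrow> M\<close> and \<open>g : F' \<rightarrow> N\<close> be surjections from finitely generated free modules with
  \<open>ker g\<close> finitely generated. By freeness, \<open>s \<phi>\<close> lifts to \<open>U : F \<rightarrow> F'\<close> along \<open>g\<close>, and
  \<open>g\<close> lifts to \<open>V : F' \<rightarrow> F\<close> along \<open>\<phi>\<close>. Then \<open>T = s - V U\<close> maps \<open>F\<close> into \<open>ker \<phi>\<close>, and
  \<open>U\<close> maps \<open>ker \<phi>\<close> into \<open>ker g\<close>, so \<open>s (ker \<phi>) \<subseteq> T(F) + V(ker g) \<subseteq> ker \<phi>\<close> with a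
  finitely generated module in the middle. A finitely generated ideal is the case \<open>M = I\<close>.\<close>

section \<open>Homomorphisms and spans\<close>

lemma mod_homI:
  assumes "module R M" "module R N"
    and "\<And>x. x \<in> carrier M \<Longrightarrow> f x \<in> carrier N"
    and "\<And>x y. x \<in> carrier M \<Longrightarrow> y \<in> carrier M \<Longrightarrow> f (x \<oplus>\<^bsub>M\<^esub> y) = f x \<oplus>\<^bsub>N\<^esub> f y"
    and "\<And>r x. r \<in> carrier R \<Longrightarrow> x \<in> carrier M \<Longrightarrow> f (r \<odot>\<^bsub>M\<^esub> x) = r \<odot>\<^bsub>N\<^esub> f x"
  shows "mod_hom R M N f"
  using assms by (simp add: mod_hom_def mod_hom_axioms_def module_hom_def)

lemma mod_hom_comp:
  assumes "mod_hom R M N f" "mod_hom R N P g"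
  shows "mod_hom R M P (\<lambda>x. g (f x))"
proof -
  interpret f: mod_hom R M N f by fact
  interpret g: mod_hom R N P g by fact
  show ?thesis
    by (rule mod_homI) (simp_all add: f.M.module_axioms g.N.module_axioms)
qed

text \<open>Linearity rests on commutativity of \<open>R\<close>: both \<open>s r\<close> and
  \<open>r s\<close> occur as factors. This is the \<open>s\<close> in
  \<open>T = s - V U\<close>.\<close>

lemma (in module) mod_hom_smult_const:
  assumes s: "s \<in> carrier R"
  shows "mod_hom R M M (\<lambda>x. s \<odot>\<^bsub>M\<^esub> x)"
  by (rule mod_homI)
    (use s in \<open>simp_all add: module_axioms smult_r_distr smult_assoc_simp R.m_comm\<close>)

lemma mod_hom_diff:
  assumes "mod_hom R M N f" "mod_hom R M N g"
  shows "mod_hom R M N (\<lambda>x. f x \<ominus>\<^bsub>N\<^esub> g x)"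
proof -
  interpret f: mod_hom R M N f by fact
  interpret g: mod_hom R M N g by fact
  show ?thesis
  proof (rule mod_homI)
    fix x y assume xy: "x \<in> carrier M" "y \<in> carrier M"
    then show "f (x \<oplus>\<^bsub>M\<^esub> y) \<ominus>\<^bsub>N\<^esub> g (x \<oplus>\<^bsub>M\<^esub> y) = f x \<ominus>\<^bsub>N\<^esub> g x \<oplus>\<^bsub>N\<^esub> (f y \<ominus>\<^bsub>N\<^esub> g y)"
      by (simp add: a_minus_def f.N.M.minus_add f.N.M.a_ac)
  next
    fix r x assume "r \<in> carrier R" "x \<in> carrier M"
    then show "f (r \<odot>\<^bsub>M\<^esub> x) \<ominus>\<^bsub>N\<^esub> g (r \<odot>\<^bsub>M\<^esub> x) = r \<odot>\<^bsub>N\<^esub> (f x \<ominus>\<^bsub>N\<^esub> g x)"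
      by (simp add: a_minus_def f.N.smult_r_distr f.N.smult_r_minus)
  qed (simp_all add: f.M.module_axioms f.N.module_axioms)
qed

text \<open>Lets a surjection onto \<open>N\<close> be read as a map into \<open>M\<close>, so that
  it can be lifted along a surjection onto \<open>M\<close>.\<close>

lemma mod_hom_extend_codomain:
  assumes "module R M" "LinearCombinations.submodule R N M"
    and "mod_hom R P (M\<lparr>carrier := N\<rparr>) f"
  shows "mod_hom R P M f"
proof -
  interpret f: mod_hom R P "M\<lparr>carrier := N\<rparr>" f by fact
  interpret N: LinearCombinations.submodule R N M by fact
  show ?thesis
    by (rule mod_homI)
      (use f.f_im f.f_add f.f_smult N.subset in \<open>auto simp: assms(1) f.M.module_axioms\<close>)
qed

text \<open>The converse passage: a map into \<open>M\<close> whose values lie in \<open>N\<close>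
  can then be lifted along a surjection onto \<open>N\<close>.\<close>

lemma mod_hom_restrict_codomain:
  assumes "LinearCombinations.submodule R N M" "mod_hom R P M f" "f ` carrier P \<subseteq> N"
  shows "mod_hom R P (M\<lparr>carrier := N\<rparr>) f"
proof -
  interpret f: mod_hom R P M f by fact
  show ?thesis
    by (rule mod_homI)
      (use assms(3) in \<open>auto simp: f.N.submodule_is_module[OF assms(1)] f.M.module_axioms\<close>)
qed

lemma (in module) mod_hom_inclusion:
  assumes "LinearCombinations.submodule R N M"
  shows "mod_hom R (M\<lparr>carrier := N\<rparr>) M (\<lambda>x. x)"
proof -
  interpret N: LinearCombinations.submodule R N M by fact
  show ?thesis
    by (rule mod_homI)
      (use N.subset in \<open>auto simp: submodule_is_module[OF assms] module_axioms\<close>)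
qed

text \<open>The preimage of \<open>L\<close> is a submodule containing \<open>A\<close>, hence
  contains the span of \<open>A\<close>.\<close>

lemma mod_hom_span_into_submodule:
  assumes "mod_hom R M N f" "LinearCombinations.submodule R L N"
    and "A \<subseteq> carrier M" "f ` A \<subseteq> L"
  shows "f ` module.span R M A \<subseteq> L"
proof -
  interpret f: mod_hom R M N f by fact
  interpret L: LinearCombinations.submodule R L N by fact
  have "LinearCombinations.submodule R {x \<in> carrier M. f x \<in> L} M"
    by (rule LinearCombinations.submodule.intro) (auto simp: f.M.module_axioms)
  with assms(3,4) show ?thesis
    using f.M.span_is_subset[of A "{x \<in> carrier M. f x \<in> L}"] by blast
qed

text \<open>The equalizer of \<open>f\<close> and \<open>g\<close> is a submodule containing
  \<open>A\<close>.\<close>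

lemma mod_hom_eq_on_span:
  assumes "mod_hom R M N f" "mod_hom R M N g"
    and "A \<subseteq> carrier M" "\<And>a. a \<in> A \<Longrightarrow> f a = g a" "x \<in> module.span R M A"
  shows "f x = g x"
proof -
  interpret f: mod_hom R M N f by fact
  interpret g: mod_hom R M N g by fact
  have "LinearCombinations.submodule R {x \<in> carrier M. f x = g x} M"
    by (rule LinearCombinations.submodule.intro) (auto simp: f.M.module_axioms)
  with assms(3-5) show ?thesis
    using f.M.span_is_subset[of A "{x \<in> carrier M. f x = g x}"] by blast
qed

section \<open>Free modules\<close>

text \<open>The family \<open>m\<close> is indexed and may repeat elements, which
  \<open>lincomb\<close> over a set cannot express. Repetition does occur when the
  \<open>m i\<close> are prescribed images of basis elements.\<close>

lemma (in module) mod_hom_finsum_coordinates: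
  assumes I: "finite I" and m: "m \<in> I \<rightarrow> carrier M"
  shows "mod_hom R (func_space I) M (\<lambda>x. \<Oplus>\<^bsub>M\<^esub>i\<in>I. x i \<odot>\<^bsub>M\<^esub> m i)"
proof (rule mod_homI)
  fix x y assume "x \<in> carrier (func_space I)" "y \<in> carrier (func_space I)"
  then have xy: "x \<in> I \<rightarrow> carrier R" "y \<in> I \<rightarrow> carrier R"
    by (auto simp: func_space_def)
  have "(\<Oplus>\<^bsub>M\<^esub>i\<in>I. (x \<oplus>\<^bsub>func_space I\<^esub> y) i \<odot>\<^bsub>M\<^esub> m i)
      = (\<Oplus>\<^bsub>M\<^esub>i\<in>I. x i \<odot>\<^bsub>M\<^esub> m i \<oplus>\<^bsub>M\<^esub> y i \<odot>\<^bsub>M\<^esub> m i)"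
    using xy m by (intro M.finsum_cong') (auto simp: func_space_def smult_l_distr Pi_iff)
  also have "\<dots> = (\<Oplus>\<^bsub>M\<^esub>i\<in>I. x i \<odot>\<^bsub>M\<^esub> m i) \<oplus>\<^bsub>M\<^esub> (\<Oplus>\<^bsub>M\<^esub>i\<in>I. y i \<odot>\<^bsub>M\<^esub> m i)"
    using xy m by (intro M.finsum_addf) (auto simp: Pi_iff)
  finally show "(\<Oplus>\<^bsub>M\<^esub>i\<in>I. (x \<oplus>\<^bsub>func_space I\<^esub> y) i \<odot>\<^bsub>M\<^esub> m i)
      = (\<Oplus>\<^bsub>M\<^esub>i\<in>I. x i \<odot>\<^bsub>M\<^esub> m i) \<oplus>\<^bsub>M\<^esub> (\<Oplus>\<^bsub>M\<^esub>i\<in>I. y i \<odot>\<^bsub>M\<^esub> m i)" .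
next
  fix r x assume r: "r \<in> carrier R" and "x \<in> carrier (func_space I)"
  then have x: "x \<in> I \<rightarrow> carrier R"
    by (auto simp: func_space_def)
  have "r \<odot>\<^bsub>M\<^esub> (\<Oplus>\<^bsub>M\<^esub>i\<in>I. x i \<odot>\<^bsub>M\<^esub> m i) = (\<Oplus>\<^bsub>M\<^esub>i\<in>I. r \<odot>\<^bsub>M\<^esub> (x i \<odot>\<^bsub>M\<^esub> m i))"
    using I r x m by (intro finsum_smult) (auto simp: Pi_iff)
  also have "\<dots> = (\<Oplus>\<^bsub>M\<^esub>i\<in>I. (r \<odot>\<^bsub>func_space I\<^esub> x) i \<odot>\<^bsub>M\<^esub> m i)"
    using r x m by (intro M.finsum_cong') (auto simp: func_space_def smult_assoc1 Pi_iff)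
  finally show "(\<Oplus>\<^bsub>M\<^esub>i\<in>I. (r \<odot>\<^bsub>func_space I\<^esub> x) i \<odot>\<^bsub>M\<^esub> m i) = r \<odot>\<^bsub>M\<^esub> (\<Oplus>\<^bsub>M\<^esub>i\<in>I. x i \<odot>\<^bsub>M\<^esub> m i)" ..
next
  fix x assume "x \<in> carrier (func_space I)"
  then show "(\<Oplus>\<^bsub>M\<^esub>i\<in>I. x i \<odot>\<^bsub>M\<^esub> m i) \<in> carrier M"
    using m by (intro M.finsum_closed) (auto simp: func_space_def Pi_iff)
qed (simp_all add: func_space_is_module module_axioms)

lemma mod_hom_inv_into:
  assumes "mod_hom R M N f" and bij: "bij_betw f (carrier M) (carrier N)"
  shows "mod_hom R N M (inv_into (carrier M) f)"
proof -
  interpret f: mod_hom R M N f by fact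
  note inj = bij_betw_imp_inj_on[OF bij] and im = bij_betw_imp_surj_on[OF bij]
  have cl: "inv_into (carrier M) f y \<in> carrier M" if "y \<in> carrier N" for y
    using that im by (metis inv_into_into)
  have eq: "f (inv_into (carrier M) f y) = y" if "y \<in> carrier N" for y
    using that im by (metis f_inv_into_f)
  show ?thesis
    by (rule mod_homI)
      (use cl eq inj in \<open>auto intro!: inv_into_f_eq simp: f.M.module_axioms f.N.module_axioms\<close>)
qed

text \<open>A basis makes \<open>lincomb\<close> an isomorphism from the coordinate module on
  \<open>B\<close> to \<open>F\<close>. The extension takes coordinates by its inverse and then
  forms the combination of the \<open>v b\<close>.\<close>

lemma free_module_hom_extension:
  assumes "module R F" "module R M"
    and B: "finite B" "B \<subseteq> carrier F" "module.span R F B = carrier F" "\<not> module.lin_dep R F B"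
    and v: "v \<in> B \<rightarrow> carrier M"
  shows "\<exists>h. mod_hom R F M h \<and> (\<forall>b\<in>B. h b = v b)"
proof -
  interpret F: module R F by fact
  interpret M: module R M by fact
  let ?C = "F.R.func_space B" and ?L = "\<lambda>a. F.lincomb a B"
  let ?E = "\<lambda>x. \<Oplus>\<^bsub>M\<^esub>b\<in>B. x b \<odot>\<^bsub>M\<^esub> v b"
  interpret L: mod_hom R ?C F ?L
    using B(1,2) by (rule F.lincomb_is_mod_hom)
  have inj: "inj_on ?L (carrier ?C)"
  proof (rule inj_onI)
    fix x y assume xy: "x \<in> carrier ?C" "y \<in> carrier ?C" "?L x = ?L y"
    then have xy': "x \<in> B \<rightarrow>\<^sub>E carrier R" "y \<in> B \<rightarrow>\<^sub>E carrier R"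
      by (auto simp: F.R.func_space_def)
    \<comment> \<open>Two coordinate vectors with the same image differ by a linear relation on
      \<open>B\<close>, which independence forces to be trivial.\<close>
    have "F.lincomb (\<lambda>b. x b \<ominus>\<^bsub>R\<^esub> y b) B = ?L x \<ominus>\<^bsub>F\<^esub> ?L y"
      using xy' B by (intro F.lincomb_diff) auto
    also have "\<dots> = \<zero>\<^bsub>F\<^esub>"
      using xy by simp
    finally have "\<forall>b\<in>B. x b \<ominus>\<^bsub>R\<^esub> y b = \<zero>\<^bsub>R\<^esub>"
      using F.lin_dep_crit[OF B(1) subset_refl, of "\<lambda>b. x b \<ominus>\<^bsub>R\<^esub> y b"] B(4) xy'
      by (auto simp: PiE_mem)
    then have "\<forall>b\<in>B. x b = y b"
      using PiE_mem[OF xy'(1)] PiE_mem[OF xy'(2)] F.R.minus_other_side by blast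
    then show "x = y"
      by (intro PiE_ext[OF xy']) simp
  qed
  have im: "?L ` carrier ?C = carrier F"
  proof
    show "carrier F \<subseteq> ?L ` carrier ?C"
    proof
      fix x assume "x \<in> carrier F"
      then obtain a where a: "a \<in> B \<rightarrow> carrier R" "F.lincomb a B = x"
        using F.finite_in_span[OF B(1,2)] B(3) by blast
      \<comment> \<open>Elements of \<open>func_space B\<close> are extensional, whereas
        \<open>a\<close> is arbitrary outside \<open>B\<close>; cutting it down does not change the
        combination.\<close>
      then have "?L (restrict a B) = x"
        using B(2) F.lincomb_cong[OF refl B(2), of "restrict a B" a] by simp
      moreover have "restrict a B \<in> carrier ?C"
        using a by (auto simp: F.R.func_space_def)
      ultimately show "x \<in> ?L ` carrier ?C" by blast
    qed
  qed auto
  have inv: "mod_hom R F ?C (inv_into (carrier ?C) ?L)"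
    by (rule mod_hom_inv_into[OF L.mod_hom_axioms]) (use inj im in \<open>simp add: bij_betw_def\<close>)
  have ext: "mod_hom R ?C M ?E"
    using B(1) v by (rule M.mod_hom_finsum_coordinates)
  have "?E (inv_into (carrier ?C) ?L b) = v b" if b: "b \<in> B" for b
  proof -
    \<comment> \<open>The coordinate vector of \<open>b\<close>: the sum for \<open>?L\<close>
      collapses to \<open>b\<close>, and the one for \<open>?E\<close> to
      \<open>v b\<close>.\<close>
    let ?d = "\<lambda>c\<in>B. if b = c then \<one>\<^bsub>R\<^esub> else \<zero>\<^bsub>R\<^esub>"
    have "?L ?d = (\<Oplus>\<^bsub>F\<^esub>c\<in>B. if b = c then c else \<zero>\<^bsub>F\<^esub>)"
      unfolding F.lincomb_def using B(2) by (intro F.M.finsum_cong') auto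
    also have "\<dots> = b"
      using b B by (subst F.M.add.finprod_singleton) auto
    finally have "inv_into (carrier ?C) ?L b = ?d"
      using inj by (intro inv_into_f_eq) (auto simp: F.R.func_space_def)
    moreover have "?E ?d = (\<Oplus>\<^bsub>M\<^esub>c\<in>B. if b = c then v c else \<zero>\<^bsub>M\<^esub>)"
      using v by (intro M.M.finsum_cong') (auto simp: Pi_iff)
    moreover have "\<dots> = v b"
      using b B v by (subst M.M.add.finprod_singleton) auto
    ultimately show ?thesis by simp
  qed
  with mod_hom_comp[OF inv ext] show ?thesis by blast
qed

text \<open>Choose \<open>p\<close>-preimages of the values of \<open>h\<close> on a basis and
  extend linearly; \<open>p\<close> after the extension agrees with \<open>h\<close> on the basis,
  hence on its span.\<close>

lemma free_module_hom_lift: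
  assumes F: "finitely_generated_free R F"
    and p: "mod_hom R P N p" "p ` carrier P = carrier N"
    and h: "mod_hom R F N h"
  shows "\<exists>k. mod_hom R F P k \<and> (\<forall>x\<in>carrier F. p (k x) = h x)"
proof -
  interpret p: mod_hom R P N p by fact
  interpret h: mod_hom R F N h by fact
  obtain B where B: "finite B" "B \<subseteq> carrier F" "h.M.span B = carrier F" "\<not> h.M.lin_dep B"
    using F unfolding finitely_generated_free_def by blast
  have "\<forall>b\<in>B. \<exists>y\<in>carrier P. p y = h b"
    using B(2) h.f_im p(2) by (metis imageE subsetD)
  then obtain v where v: "\<And>b. b \<in> B \<Longrightarrow> v b \<in> carrier P \<and> p (v b) = h b"
    by metis
  then obtain k where k: "mod_hom R F P k" "\<forall>b\<in>B. k b = v b"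
    using free_module_hom_extension[OF h.M.module_axioms p.M.module_axioms B, of v] by auto
  have "p (k x) = h x" if "x \<in> carrier F" for x
    by (rule mod_hom_eq_on_span[OF mod_hom_comp[OF k(1) p(1)] h B(2)]) (use v k B that in auto)
  with k show ?thesis by blast
qed

section \<open>Coordinate modules and their standard bases\<close>

context cring
begin

text \<open>The standard basis vectors of R^I, restricted to \<open>I\<close> because elements of
  \<open>func_space I\<close> are extensional.\<close>

definition unit_fun :: "'i set \<Rightarrow> 'i \<Rightarrow> 'i \<Rightarrow> 'a" where
  "unit_fun I i = (\<lambda>j\<in>I. if j = i then \<one> else \<zero>)"

text \<open>Evaluation at a coordinate is additive. The index must lie in \<open>I\<close>, since
  elsewhere every element of the module has the value \<open>undefined\<close>.\<close>

lemma func_space_finsum_apply: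
  assumes "finite A" "f \<in> A \<rightarrow> carrier (func_space I)" "j \<in> I"
  shows "(\<Oplus>\<^bsub>func_space I\<^esub>i\<in>A. f i) j = (\<Oplus>i\<in>A. f i j)"
proof -
  interpret F: module R "func_space I" by (rule func_space_is_module)
  show ?thesis
    using assms(1,2)
  proof (induction A rule: finite_induct)
    case empty
    then show ?case using assms(3) by simp (simp add: func_space_def)
  next
    case (insert a A)
    have "(\<lambda>i. f i j) \<in> insert a A \<rightarrow> carrier R"
      using insert.prems assms(3) by (fastforce simp: func_space_def)
    moreover have "(\<Oplus>\<^bsub>func_space I\<^esub>i\<in>insert a A. f i)
        = f a \<oplus>\<^bsub>func_space I\<^esub> (\<Oplus>\<^bsub>func_space I\<^esub>i\<in>A. f i)"
      using insert by (intro F.finsum_insert) auto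
    ultimately show ?case
      using insert assms(3) by (simp add: func_space_def Pi_iff)
  qed
qed

lemma unit_fun_closed: "unit_fun I i \<in> carrier (func_space I)"
  by (auto simp: unit_fun_def func_space_def)

lemma func_space_finsum_unit_fun:
  assumes I: "finite I" and c: "c \<in> I \<rightarrow> carrier R"
  shows "(\<Oplus>\<^bsub>func_space I\<^esub>i\<in>I. c i \<odot>\<^bsub>func_space I\<^esub> unit_fun I i) = restrict c I" (is "?s = _")
proof -
  interpret F: module R "func_space I" by (rule func_space_is_module)
  have cl: "(\<lambda>i. c i \<odot>\<^bsub>func_space I\<^esub> unit_fun I i) \<in> I \<rightarrow> carrier (func_space I)"
    using c by (auto intro!: F.smult_closed simp: unit_fun_closed Pi_iff)
  have "?s \<in> carrier (func_space I)"
    using cl by (rule F.finsum_closed)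
  then have "?s \<in> I \<rightarrow>\<^sub>E carrier R" by (simp add: func_space_def)
  then show ?thesis
  proof (rule PiE_ext)
    show "restrict c I \<in> I \<rightarrow>\<^sub>E carrier R" using c by simp
    fix j assume j: "j \<in> I"
    have "?s j = (\<Oplus>i\<in>I. (c i \<odot>\<^bsub>func_space I\<^esub> unit_fun I i) j)"
      using I cl j by (rule func_space_finsum_apply)
    also have "\<dots> = (\<Oplus>i\<in>I. if j = i then c i else \<zero>)"
      using j c by (intro finsum_cong') (auto simp: func_space_def unit_fun_def Pi_iff)
    also have "\<dots> = c j"
      using j I c by (subst add.finprod_singleton) auto
    finally show "?s j = restrict c I j" using j by simp
  qed
qed

lemma func_space_finitely_generated_free:
  assumes I: "finite I"
  shows "finitely_generated_free R (func_space I)"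
proof -
  interpret F: module R "func_space I" by (rule func_space_is_module)
  show ?thesis
  proof (cases "\<one> = \<zero>")
    case True
    \<comment> \<open>In the zero ring the unit vectors may coincide, so the empty basis is used.\<close>
    then have "carrier R = {\<zero>}" by (rule one_zeroD)
    then have "carrier (func_space I) = {\<zero>\<^bsub>func_space I\<^esub>}"
      by (auto simp: func_space_def PiE_iff extensional_def)
    moreover have "F.span {} = {\<zero>\<^bsub>func_space I\<^esub>}" "\<not> F.lin_dep {}"
      by (auto simp: F.span_def F.lin_dep_def)
    ultimately show ?thesis
      unfolding finitely_generated_free_def using F.module_axioms by blast
  next
    case False
    let ?B = "unit_fun I ` I"
    have B: "finite ?B" "?B \<subseteq> carrier (func_space I)"
      using I by (auto simp: unit_fun_closed)
    \<comment> \<open>Evaluating at \<open>i\<close> separates the vectors because one differs from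
      zero. Injectivity allows sums over the set \<open>?B\<close> to be reindexed by
      \<open>I\<close>.\<close>
    have inj: "inj_on (unit_fun I) I"
    proof (rule inj_onI)
      fix i j assume "i \<in> I" "j \<in> I" "unit_fun I i = unit_fun I j"
      then have "unit_fun I i i = unit_fun I j i" by simp
      with \<open>i \<in> I\<close> False show "i = j" by (simp add: unit_fun_def split: if_splits)
    qed
    \<comment> \<open>A combination of unit vectors is the tuple of its coefficients; spanning and
      independence are both read off from this.\<close>
    have lincomb: "F.lincomb a ?B = (\<lambda>i\<in>I. a (unit_fun I i))" if "a \<in> ?B \<rightarrow> carrier R" for a
    proof -
      have "F.lincomb a ?B
          = (\<Oplus>\<^bsub>func_space I\<^esub>i\<in>I. a (unit_fun I i) \<odot>\<^bsub>func_space I\<^esub> unit_fun I i)"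
        unfolding F.lincomb_def using that inj
        by (intro F.M.add.finprod_reindex) (auto intro!: F.smult_closed simp: unit_fun_closed)
      also have "\<dots> = (\<lambda>i\<in>I. a (unit_fun I i))"
        using I that by (intro func_space_finsum_unit_fun) auto
      finally show ?thesis .
    qed
    have "F.span ?B = carrier (func_space I)"
    proof
      show "carrier (func_space I) \<subseteq> F.span ?B"
      proof
        fix x assume "x \<in> carrier (func_space I)"
        then have x: "x \<in> I \<rightarrow>\<^sub>E carrier R" by (simp add: func_space_def)
        \<comment> \<open>\<open>lincomb\<close> takes coefficients indexed by vectors, so the entry
          of \<open>x\<close> at \<open>i\<close> is attached to the \<open>i\<close>-th unit
          vector.\<close>
        let ?a = "\<lambda>y. x (inv_into I (unit_fun I) y)"
        have a: "?a \<in> ?B \<rightarrow> carrier R" using x inj by (auto simp: PiE_mem)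
        have "F.lincomb ?a ?B = (\<lambda>i\<in>I. x i)"
          unfolding lincomb[OF a] using inj by (intro restrict_ext) simp
        then have "F.lincomb ?a ?B = x" using x by (simp add: PiE_restrict)
        moreover have "F.lincomb ?a ?B \<in> F.span ?B"
          unfolding F.span_def using a B(1) by blast
        ultimately show "x \<in> F.span ?B" by simp
      qed
    qed (rule F.span_is_subset2[OF B(2)])
    moreover have "\<not> F.lin_dep ?B"
    proof (rule F.finite_lin_indpt2[OF B])
      fix a assume a: "a \<in> ?B \<rightarrow> carrier R" "F.lincomb a ?B = \<zero>\<^bsub>func_space I\<^esub>"
      then have *: "(\<lambda>i\<in>I. a (unit_fun I i)) = (\<lambda>i\<in>I. \<zero>)"
        using lincomb[OF a(1)] by (simp add: func_space_def)
      show "\<forall>v\<in>?B. a v = \<zero>"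
      proof
        fix v assume "v \<in> ?B"
        then obtain i where "i \<in> I" "v = unit_fun I i" by blast
        with fun_cong[OF *, of i] show "a v = \<zero>" by simp
      qed
    qed
    ultimately show ?thesis
      unfolding finitely_generated_free_def using F.module_axioms B by blast
  qed
qed

end

text \<open>Numbering the generators by an initial segment of the naturals gives the free module the
  element type \<open>nat \<Rightarrow> 'a\<close> that the definitions of presentation fix.\<close>

lemma finitely_generated_free_cover:
  fixes R :: "('a, 'r) ring_scheme" and M :: "('a, 'b, 'm) module_scheme"
  assumes "finitely_generated R M"
  shows "\<exists>(F :: ('a, nat \<Rightarrow> 'a) module) g.
    finitely_generated_free R F \<and> mod_hom R F M g \<and> g ` carrier F = carrier M"
proof -
  interpret M: module R M
    using assms by (simp add: finitely_generated_def)
  obtain A where A: "finite A" "A \<subseteq> carrier M" "M.span A = carrier M"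
    using assms unfolding finitely_generated_def by blast
  obtain m where m: "bij_betw m {..<card A} A"
    using ex_bij_betw_nat_finite[OF A(1)] by (auto simp: atLeast0LessThan)
  let ?I = "{..<card A}" and ?F = "M.R.func_space {..<card A}"
  let ?g = "\<lambda>x. \<Oplus>\<^bsub>M\<^esub>i\<in>?I. x i \<odot>\<^bsub>M\<^esub> m i"
  have mA: "m i \<in> A" if "i \<in> ?I" for i
    using m that by (rule bij_betwE[THEN bspec])
  then have mc: "m \<in> ?I \<rightarrow> carrier M" using A(2) by blast
  have hom: "mod_hom R ?F M ?g"
    using mc by (intro M.mod_hom_finsum_coordinates) auto
  interpret g: mod_hom R ?F M ?g by fact
  have "carrier M \<subseteq> ?g ` carrier ?F"
  proof
    fix x assume "x \<in> carrier M"
    then obtain a where a: "a \<in> A \<rightarrow> carrier R" "M.lincomb a A = x"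
      using M.finite_in_span[OF A(1,2)] A(3) by blast
    have "M.lincomb a (m ` ?I) = (\<Oplus>\<^bsub>M\<^esub>i\<in>?I. a (m i) \<odot>\<^bsub>M\<^esub> m i)"
      unfolding M.lincomb_def using a mA mc bij_betw_imp_inj_on[OF m]
      by (intro M.M.add.finprod_reindex) (auto intro!: M.smult_closed simp: Pi_iff)
    also have "\<dots> = ?g (\<lambda>i\<in>?I. a (m i))"
      using a mA mc by (intro M.M.finsum_cong') (auto intro!: M.smult_closed simp: Pi_iff)
    finally have "x = ?g (\<lambda>i\<in>?I. a (m i))"
      using a(2) bij_betw_imp_surj_on[OF m] by simp
    moreover have "(\<lambda>i\<in>?I. a (m i)) \<in> carrier ?F"
      using a(1) mA by (auto simp: M.R.func_space_def)
    ultimately show "x \<in> ?g ` carrier ?F" by (rule image_eqI)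
  qed
  then have "?g ` carrier ?F = carrier M" by auto
  with hom M.R.func_space_finitely_generated_free[of ?I] show ?thesis by blast
qed

section \<open>S-finite presentation\<close>

text \<open>Taking the kernel inside \<open>M\<close> itself keeps its element type that of
  \<open>M\<close>, as needed for \<open>K\<close> and \<open>F\<close> in a presentation.\<close>

lemma (in mod_hom) short_exact_ker:
  assumes "f ` carrier M = carrier N"
  shows "short_exact R (M\<lparr>carrier := ker\<rparr>) (\<lambda>x. x) M f N"
  using assms M.mod_hom_inclusion[OF ker_is_submodule] mod_hom_axioms
  by (simp add: short_exact_def ker_def)

lemma S_finitely_presentedI:
  fixes R :: "('a, 'r) ring_scheme" and M :: "('a, 'b, 'm) module_scheme"
  assumes S: "S \<subseteq> carrier R"
    and fg: "finitely_generated R M"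
    and cfp: "c_S_finitely_presented R S M"
  shows "S_finitely_presented R S M"
proof -
  interpret M: module R M
    using fg by (simp add: finitely_generated_def)
  obtain N s where N: "LinearCombinations.submodule R N M"
    and fp: "finitely_presented R (M\<lparr>carrier := N\<rparr>)"
    and s: "s \<in> S" "\<And>x. x \<in> carrier M \<Longrightarrow> s \<odot>\<^bsub>M\<^esub> x \<in> N"
    using cfp unfolding c_S_finitely_presented_def by blast
  obtain K' F' :: "('a, nat \<Rightarrow> 'a) module" and f g
    where ex: "short_exact R K' f F' g (M\<lparr>carrier := N\<rparr>)"
      and K': "finitely_generated R K'" and F': "finitely_generated_free R F'"
    using fp unfolding finitely_presented_def by blast
  obtain F :: "('a, nat \<Rightarrow> 'a) module" and \<phi>
    where F: "finitely_generated_free R F"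
      and \<phi>: "mod_hom R F M \<phi>" "\<phi> ` carrier F = carrier M"
    using finitely_generated_free_cover[OF fg] by blast
  have sR: "s \<in> carrier R" using s S by blast
  have f: "mod_hom R K' F' f" "f ` carrier K' = {x \<in> carrier F'. g x = \<zero>\<^bsub>M\<^esub>}"
    and gN: "mod_hom R F' (M\<lparr>carrier := N\<rparr>) g" "g ` carrier F' = N"
    using ex by (auto simp: short_exact_def)
  have gM: "mod_hom R F' M g"
    using mod_hom_extend_codomain[OF M.module_axioms N gN(1)] .
  interpret \<phi>: mod_hom R F M \<phi> by fact
  \<comment> \<open>Since \<open>s\<close> carries \<open>M\<close> into \<open>N\<close>, this map
    has codomain \<open>N\<close>, onto which \<open>g\<close> is surjective.\<close>
  have s\<phi>: "mod_hom R F (M\<lparr>carrier := N\<rparr>) (\<lambda>x. s \<odot>\<^bsub>M\<^esub> \<phi> x)"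
    using s(2) mod_hom_comp[OF \<phi>(1) M.mod_hom_smult_const[OF sR]]
    by (intro mod_hom_restrict_codomain[OF N]) auto
  obtain U where U: "mod_hom R F F' U" "\<And>x. x \<in> carrier F \<Longrightarrow> g (U x) = s \<odot>\<^bsub>M\<^esub> \<phi> x"
    using free_module_hom_lift[OF F gN(1) _ s\<phi>] gN(2) by (auto simp del: \<phi>.f_smult)
  obtain V where V: "mod_hom R F' F V" "\<And>y. y \<in> carrier F' \<Longrightarrow> \<phi> (V y) = g y"
    using free_module_hom_lift[OF F' \<phi> gM] by blast
  interpret f: mod_hom R K' F' f by fact
  interpret U: mod_hom R F F' U by fact
  interpret V: mod_hom R F' F V by fact
  define T where "T x = s \<odot>\<^bsub>F\<^esub> x \<ominus>\<^bsub>F\<^esub> V (U x)" for x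
  have T: "mod_hom R F F T"
    unfolding T_def
    by (intro mod_hom_diff \<phi>.M.mod_hom_smult_const sR mod_hom_comp[OF U(1) V(1)])
  \<comment> \<open>Applying \<open>\<phi>\<close> to \<open>V (U x)\<close> gives
    \<open>g (U x)\<close>, which is \<open>s\<close> times \<open>\<phi> x\<close>, so the two
    terms cancel.\<close>
  have T_ker: "T x \<in> \<phi>.ker" if "x \<in> carrier F" for x
    using that sR by (simp add: \<phi>.ker_def T_def U(2) V(2))
  have Vf: "mod_hom R K' F (\<lambda>x. V (f x))"
    using f(1) V(1) by (rule mod_hom_comp)
  \<comment> \<open>Here \<open>\<phi> (V (f x)) = g (f x)\<close>, which vanishes by
    exactness.\<close>
  have Vf_ker: "V (f x) \<in> \<phi>.ker" if "x \<in> carrier K'" for x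
    using that f(2) V(2) by (auto simp: \<phi>.ker_def)
  obtain B where B: "finite B" "B \<subseteq> carrier F" "\<phi>.M.span B = carrier F"
    using F unfolding finitely_generated_free_def by blast
  obtain A where A: "finite A" "A \<subseteq> carrier K'" "f.M.span A = carrier K'"
    using K' unfolding finitely_generated_def by blast
  \<comment> \<open>Images of finite generating sets of \<open>F\<close> and \<open>K'\<close>;
    together they generate \<open>T(F) + V(ker g)\<close>, as \<open>f\<close> maps
    \<open>K'\<close> onto the kernel of \<open>g\<close>.\<close>
  define G where "G = T ` B \<union> (\<lambda>x. V (f x)) ` A"
  have G: "finite G" "G \<subseteq> \<phi>.ker"
    using A B T_ker Vf_ker by (auto simp: G_def)
  then have GF: "G \<subseteq> carrier F" by (auto simp: \<phi>.ker_def)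
  note span = \<phi>.M.span_is_submodule[OF GF]
  interpret span: LinearCombinations.submodule R "\<phi>.M.span G" F by (rule span)
  have G_span: "G \<subseteq> \<phi>.M.span G"
    using GF by (rule \<phi>.M.in_own_span)
  have span_ker: "\<phi>.M.span G \<subseteq> \<phi>.ker"
    using G(2) \<phi>.ker_is_submodule by (rule \<phi>.M.span_is_subset)
  let ?K = "F\<lparr>carrier := \<phi>.ker\<rparr>"
  have K: "module R ?K"
    using \<phi>.ker_is_submodule by (rule \<phi>.M.submodule_is_module)
  have "s \<odot>\<^bsub>F\<^esub> x \<in> \<phi>.M.span G" if "x \<in> \<phi>.ker" for x
  proof -
    have x: "x \<in> carrier F" "\<phi> x = \<zero>\<^bsub>M\<^esub>" using that by (auto simp: \<phi>.ker_def)
    have "T x \<in> \<phi>.M.span G"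
      using mod_hom_span_into_submodule[OF T span B(2)] G_span B(3) x(1) by (auto simp: G_def)
    moreover have "U x \<in> f ` carrier K'"
      using x U(2) sR by (auto simp: f(2))
    then have "V (U x) \<in> \<phi>.M.span G"
      using mod_hom_span_into_submodule[OF Vf span A(2)] G_span A(3) by (auto simp: G_def)
    moreover have "s \<odot>\<^bsub>F\<^esub> x = T x \<oplus>\<^bsub>F\<^esub> V (U x)"
      using x sR by (simp add: T_def a_minus_def \<phi>.M.M.a_assoc \<phi>.M.M.l_neg)
    ultimately show ?thesis by simp
  qed
  moreover have "LinearCombinations.submodule R (\<phi>.M.span G) ?K"
    by (rule LinearCombinations.submodule.intro) (use K span_ker in auto)
  moreover have "finitely_generated R (F\<lparr>carrier := \<phi>.M.span G\<rparr>)"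
    using G(1) G_span \<phi>.M.submodule_is_module[OF span] \<phi>.M.span_li_not_depend(1)[OF G_span span]
    by (auto simp: finitely_generated_def)
  ultimately have "S_finite R S ?K"
    using K s(1) unfolding S_finite_def by (auto intro!: exI[of _ "\<phi>.M.span G"] bexI)
  with \<phi>.short_exact_ker[OF \<phi>(2)] F show ?thesis
    unfolding S_finitely_presented_def by blast
qed

lemma (in cring) ideal_module_submodule_ideal:
  assumes "LinearCombinations.submodule R J (ideal_module R I)" "I \<subseteq> carrier R"
  shows "ideal J R"
proof -
  interpret J: LinearCombinations.submodule R J "ideal_module R I" by fact
  have J: "J \<subseteq> carrier R"
    using J.subset assms(2) by (auto simp: ideal_module_def)
  have add: "x \<oplus> y \<in> J" if "x \<in> J" "y \<in> J" for x y
    using J.m_closed[OF that] by (simp add: ideal_module_def)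
  have mult: "r \<otimes> x \<in> J" if "r \<in> carrier R" "x \<in> J" for r x
    using J.smult_closed[OF that] by (simp add: ideal_module_def)
  have zero: "\<zero> \<in> J"
    using J.zero_closed by (simp add: ideal_module_def)
  show ?thesis
  proof (rule idealI)
    show "subgroup J (add_monoid R)"
    proof (rule add.subgroupI)
      fix x assume "x \<in> J"
      moreover from this have "\<ominus> x = (\<ominus> \<one>) \<otimes> x" using J by (auto simp: l_minus)
      ultimately show "\<ominus> x \<in> J" using mult by simp
    qed (use J add zero in auto)
    fix a x assume ax: "a \<in> J" "x \<in> carrier R"
    then show "x \<otimes> a \<in> J" by (intro mult)
    with ax J show "a \<otimes> x \<in> J" by (metis m_comm subsetD)
  qed (rule ring_axioms)
qed

lemma (in cring) finitely_generated_ideal_module: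
  assumes "finitely_generated_ideal R I" "module R (ideal_module R I)"
  shows "finitely_generated R (ideal_module R I)"
proof -
  interpret I: module R "ideal_module R I" by fact
  obtain A where A: "finite A" "A \<subseteq> carrier R" "I = Idl A"
    using assms(1) unfolding finitely_generated_ideal_def by blast
  have I: "I \<subseteq> carrier R"
    using ideal.Icarr[OF genideal_ideal[OF A(2)]] A(3) by blast
  have car: "carrier (ideal_module R I) = I" by (simp add: ideal_module_def)
  have AI: "A \<subseteq> carrier (ideal_module R I)"
    using genideal_self[OF A(2)] A(3) car by simp
  have "ideal (I.span A) R"
    using I.span_is_submodule[OF AI] I by (rule ideal_module_submodule_ideal)
  then have "I \<subseteq> I.span A"
    unfolding A(3) using I.in_own_span[OF AI] A(3) by (intro genideal_minimal) auto
  then have "I.span A = carrier (ideal_module R I)"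
    using I.span_is_subset2[OF AI] car by blast
  with A(1) AI assms(2) show ?thesis
    unfolding finitely_generated_def by blast
qed

theorem theorem12:
  fixes R :: "('a, 'r) ring_scheme" and S :: "'a set"
  assumes "cring R"
    and "submonoid S R"
    and "c_S_coherent R S"
  shows "S_coherent R S"
  unfolding S_coherent_def
proof (intro allI impI)
  fix I assume I: "finitely_generated_ideal R I"
  with assms(3) have cfp: "c_S_finitely_presented R S (ideal_module R I)"
    by (simp add: c_S_coherent_def)
  then have "finitely_generated R (ideal_module R I)"
    using cring.finitely_generated_ideal_module[OF assms(1) I]
    by (simp add: c_S_finitely_presented_def)
  with cfp show "S_finitely_presented R S (ideal_module R I)"
    using S_finitely_presentedI submonoid.subset[OF assms(2)] by blast
qed

end
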